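(* Let $X$ and $Y$ be locally compact Hausdorff spaces, and let $T:C_0^+(X)\to C_0^+(Y)$ be a positive homogeneous order isomorphism. Then $T$ extends uniquely to a linear order isomorphism $\widetilde T:C_0(X)\to C_0(Y)$; that is, there is exactly one linear order isomorphism $\widetilde T:C_0(X)\to C_0(Y)$ with $\widetilde T(f)=T(f)$ for all $f\in C_0^+(X)$.
   Context: For a locally compact Hausdorff space $X$, $C_0(X)$ denotes the Banach space of all real-valued continuous functions on $X$ vanishing at infinity (supremum norm), and $C_0^+(X)=\{f\in C_0(X): f(x)\ge 0 \text{ for all } x\in X\}$. Both are ordered pointwise: $f\le g$ iff $f(x)\le g(x)$ for all $x\in X$. A mapping $T:C_0^+(X)\to C_0^+(Y)$ is an order isomorphism if it is bijective and $f\le g\iff T(f)\le T(g)$ for all $f,g\in C_0^+(X)$. It is positive homogeneous if $T(rf)=rT(f)$ for all real $r>0$ and $f\in C_0^+(X)$. A linear order isomorphism $\widetilde T:C_0(X)\to C_0(Y)$ is a bijective linear map with $f\le g\iff\widetilde T(f)\le\widetilde T(g)$ for all $f,g\in C_0(X)$. *)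

theory Defs
  imports "HOL-Analysis.Analysis"
begin

text \<open>
  A function on a space \<open>X :: 'a topology\<close> is represented by a total function on \<open>'a\<close> that is
  \<open>0\<close> off \<open>topspace X\<close>. Hence the representation is unique, \<open>C0 X\<close> is closed under the
  pointwise operations of \<open>'a \<Rightarrow> real\<close>, and the order \<open>\<le>\<close> of type \<open>'a \<Rightarrow> real\<close> restricted to
  \<open>C0 X\<close> is the pointwise order on \<open>topspace X\<close>.
\<close>

definition C0 :: "'a topology \<Rightarrow> ('a \<Rightarrow> real) set" where
  "C0 X = {f. continuous_map X euclideanreal f \<and>
              (\<forall>e>0. compactin X {x \<in> topspace X. \<bar>f x\<bar> \<ge> e}) \<and>
              (\<forall>x. x \<notin> topspace X \<longrightarrow> f x = 0)}"

definition C0_plus :: "'a topology \<Rightarrow> ('a \<Rightarrow> real) set" where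
  "C0_plus X = {f \<in> C0 X. \<forall>x \<in> topspace X. f x \<ge> 0}"

definition order_isomorphism_on :: "'f::ord set \<Rightarrow> 'g::ord set \<Rightarrow> ('f \<Rightarrow> 'g) \<Rightarrow> bool" where
  "order_isomorphism_on A B T \<longleftrightarrow>
     bij_betw T A B \<and> (\<forall>f\<in>A. \<forall>g\<in>A. f \<le> g \<longleftrightarrow> T f \<le> T g)"

definition positive_homogeneous_on ::
    "('a \<Rightarrow> real) set \<Rightarrow> (('a \<Rightarrow> real) \<Rightarrow> ('b \<Rightarrow> real)) \<Rightarrow> bool" where
  "positive_homogeneous_on A T \<longleftrightarrow>
     (\<forall>r>0. \<forall>f\<in>A. T (\<lambda>x. r * f x) = (\<lambda>y. r * T f y))"

definition linear_map_on ::
    "('a \<Rightarrow> real) set \<Rightarrow> (('a \<Rightarrow> real) \<Rightarrow> ('b \<Rightarrow> real)) \<Rightarrow> bool" where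
  "linear_map_on A T \<longleftrightarrow>
     (\<forall>f\<in>A. \<forall>g\<in>A. T (\<lambda>x. f x + g x) = (\<lambda>y. T f y + T g y)) \<and>
     (\<forall>r. \<forall>f\<in>A. T (\<lambda>x. r * f x) = (\<lambda>y. r * T f y))"

definition linear_order_isomorphism ::
    "'a topology \<Rightarrow> 'b topology \<Rightarrow> (('a \<Rightarrow> real) \<Rightarrow> ('b \<Rightarrow> real)) \<Rightarrow> bool" where
  "linear_order_isomorphism X Y T \<longleftrightarrow>
     linear_map_on (C0 X) T \<and> order_isomorphism_on (C0 X) (C0 Y) T"

end

theory Submission
  imports Defs
begin

text \<open>
  An order isomorphism between the lattices \<open>C0_plus X\<close> and \<open>C0_plus Y\<close> preserves binary maxima
  and minima. For \<open>a, b > 0\<close> one has pointwise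
  \<open>min (f/a) (g/b) \<le> (f + g)/(a + b) \<le> max (f/a) (g/b)\<close>. Applying \<open>T\<close>, evaluating at a point
  \<open>y\<close> and letting \<open>a\<close>, \<open>b\<close> tend to \<open>T f y\<close>, \<open>T g y\<close> shows that \<open>T\<close> is additive. The extension
  is then \<open>T f\<^sup>+ - T f\<^sup>-\<close>; no representation of \<open>T\<close> as a weighted composition is needed.
\<close>

section \<open>Closure properties of \<open>C0\<close> and its positive cone\<close>

lemma C0_dominated:
  assumes f: "f \<in> C0 X" and g: "g \<in> C0 X" and c: "c > 0"
    and h: "continuous_map X euclideanreal h"
    and bound: "\<And>x. \<bar>h x\<bar> \<le> c * (\<bar>f x\<bar> + \<bar>g x\<bar>)"
  shows "h \<in> C0 X"
proof -
  have "compactin X {x \<in> topspace X. e \<le> \<bar>h x\<bar>}" if "e > 0" for e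
  \<comment> \<open>If both \<open>\<bar>f x\<bar>\<close> and \<open>\<bar>g x\<bar>\<close> were
    below \<open>e / (2 * c)\<close>, the bound would give \<open>\<bar>h x\<bar> < e\<close>. So
    the superlevel set of \<open>h\<close> is a closed subset of the union of two compact
    ones.\<close>
  proof (rule closed_compactin)
    have "e / (2 * c) > 0"
      using that c by simp
    then show "compactin X ({x \<in> topspace X. e / (2 * c) \<le> \<bar>f x\<bar>} \<union>
        {x \<in> topspace X. e / (2 * c) \<le> \<bar>g x\<bar>})"
      using f g unfolding C0_def by (intro compactin_Un) auto
    have "e / (2 * c) \<le> \<bar>f x\<bar> \<or> e / (2 * c) \<le> \<bar>g x\<bar>" if "e \<le> \<bar>h x\<bar>" for x
    proof (rule ccontr)
      assume "\<not> ?thesis"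
      then have "\<bar>f x\<bar> + \<bar>g x\<bar> < e / c"
        by (simp add: field_simps)
      then show False
        using bound[of x] that c by (simp add: field_simps)
    qed
    then show "{x \<in> topspace X. e \<le> \<bar>h x\<bar>} \<subseteq> {x \<in> topspace X. e / (2 * c) \<le> \<bar>f x\<bar>} \<union>
        {x \<in> topspace X. e / (2 * c) \<le> \<bar>g x\<bar>}"
      by auto
    have "closedin X {x \<in> topspace X. \<bar>h x\<bar> \<in> {e..}}"
      by (rule closedin_continuous_map_preimage[where Y = euclideanreal])
        (auto intro!: continuous_map_real_abs h)
    then show "closedin X {x \<in> topspace X. e \<le> \<bar>h x\<bar>}"
      by simp
  qed
  moreover have "h x = 0" if "x \<notin> topspace X" for x
    using bound[of x] f g that by (simp add: C0_def)
  ultimately show ?thesis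
    using h by (simp add: C0_def)
qed

lemma C0_continuous_map: "f \<in> C0 X \<Longrightarrow> continuous_map X euclideanreal f"
  by (simp add: C0_def)

lemma C0_add: "f \<in> C0 X \<Longrightarrow> g \<in> C0 X \<Longrightarrow> (\<lambda>x. f x + g x) \<in> C0 X"
  by (rule C0_dominated[where f = f and g = g and c = 1])
    (auto intro: continuous_map_add C0_continuous_map)

lemma C0_diff: "f \<in> C0 X \<Longrightarrow> g \<in> C0 X \<Longrightarrow> (\<lambda>x. f x - g x) \<in> C0 X"
  by (rule C0_dominated[where f = f and g = g and c = 1])
    (auto intro: continuous_map_diff C0_continuous_map)

lemma C0_max: "f \<in> C0 X \<Longrightarrow> g \<in> C0 X \<Longrightarrow> (\<lambda>x. max (f x) (g x)) \<in> C0 X"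
  by (rule C0_dominated[where f = f and g = g and c = 1])
    (auto intro: continuous_map_real_max C0_continuous_map)

lemma C0_min: "f \<in> C0 X \<Longrightarrow> g \<in> C0 X \<Longrightarrow> (\<lambda>x. min (f x) (g x)) \<in> C0 X"
  by (rule C0_dominated[where f = f and g = g and c = 1])
    (auto intro: continuous_map_real_min C0_continuous_map)

lemma C0_scale: "f \<in> C0 X \<Longrightarrow> (\<lambda>x. r * f x) \<in> C0 X"
  \<comment> \<open>The summand \<open>1\<close> keeps the constant positive when
    \<open>r = 0\<close>.\<close>
  by (rule C0_dominated[where f = f and g = f and c = "\<bar>r\<bar> + 1"])
    (auto intro: continuous_map_real_mult_left C0_continuous_map
      simp: abs_mult algebra_simps)

lemma C0_zero: "(\<lambda>x. 0) \<in> C0 X"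
  by (simp add: C0_def)

text \<open>Members of \<open>C0 X\<close> vanish off \<open>topspace X\<close>, so the sign
  condition may range over the whole type, as the order on functions does.\<close>

lemma C0_plus_iff: "f \<in> C0_plus X \<longleftrightarrow> f \<in> C0 X \<and> (\<forall>x. 0 \<le> f x)"
  by (force simp: C0_plus_def C0_def)

lemma C0_plus_max: "f \<in> C0_plus X \<Longrightarrow> g \<in> C0_plus X \<Longrightarrow> (\<lambda>x. max (f x) (g x)) \<in> C0_plus X"
  by (simp add: C0_plus_iff C0_max le_max_iff_disj)

lemma C0_plus_min: "f \<in> C0_plus X \<Longrightarrow> g \<in> C0_plus X \<Longrightarrow> (\<lambda>x. min (f x) (g x)) \<in> C0_plus X"
  by (simp add: C0_plus_iff C0_min)

lemma C0_plus_add: "f \<in> C0_plus X \<Longrightarrow> g \<in> C0_plus X \<Longrightarrow> (\<lambda>x. f x + g x) \<in> C0_plus X"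
  by (simp add: C0_plus_iff C0_add)

lemma C0_plus_scale: "f \<in> C0_plus X \<Longrightarrow> 0 \<le> r \<Longrightarrow> (\<lambda>x. r * f x) \<in> C0_plus X"
  by (simp add: C0_plus_iff C0_scale)

lemma C0_pos_part: "f \<in> C0 X \<Longrightarrow> (\<lambda>x. max (f x) 0) \<in> C0_plus X"
  by (simp add: C0_plus_iff C0_max C0_zero)

lemma C0_neg_part: "f \<in> C0 X \<Longrightarrow> (\<lambda>x. max (- f x) 0) \<in> C0_plus X"
  using C0_pos_part[OF C0_scale[of f X "-1"]] by simp

section \<open>Lattice operations and additivity of \<open>T\<close>\<close>

locale homogeneous_order_isomorphism =
  fixes X :: "'a topology" and Y :: "'b topology"
    and T :: "('a \<Rightarrow> real) \<Rightarrow> ('b \<Rightarrow> real)"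
  assumes order_iso: "order_isomorphism_on (C0_plus X) (C0_plus Y) T"
    and homogeneous: "positive_homogeneous_on (C0_plus X) T"
begin

lemma maps_into: "f \<in> C0_plus X \<Longrightarrow> T f \<in> C0_plus Y"
  using order_iso by (auto simp: order_isomorphism_on_def bij_betw_def)

lemma le_iff: "f \<in> C0_plus X \<Longrightarrow> g \<in> C0_plus X \<Longrightarrow> T f \<le> T g \<longleftrightarrow> f \<le> g"
  using order_iso by (auto simp: order_isomorphism_on_def)

lemma mono: "f \<in> C0_plus X \<Longrightarrow> g \<in> C0_plus X \<Longrightarrow> (\<And>x. f x \<le> g x) \<Longrightarrow> T f y \<le> T g y"
  using le_iff[of f g] by (auto simp: le_fun_def)

lemma surjective:
  assumes "g \<in> C0_plus Y"
  obtains f where "f \<in> C0_plus X" "T f = g"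
proof -
  have "g \<in> T ` C0_plus X"
    using assms order_iso by (simp add: order_isomorphism_on_def bij_betw_def)
  then show thesis
    by (rule imageE) (rule that, simp_all)
qed

lemma nonneg: "f \<in> C0_plus X \<Longrightarrow> 0 \<le> T f y"
  using maps_into by (auto simp: C0_plus_iff)

lemma scale: "f \<in> C0_plus X \<Longrightarrow> r > 0 \<Longrightarrow> T (\<lambda>x. r * f x) = (\<lambda>y. r * T f y)"
  using homogeneous by (simp add: positive_homogeneous_on_def)

text \<open>Since \<open>T\<close> reflects the order, the preimage \<open>h\<close> of the
  pointwise maximum of \<open>T f\<close> and \<open>T g\<close> is an upper bound of
  \<open>f\<close> and \<open>g\<close>, hence of their maximum. The opposite inequality is plain
  monotonicity.\<close>

lemma max_le:
  assumes f: "f \<in> C0_plus X" and g: "g \<in> C0_plus X"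
  shows "T (\<lambda>x. max (f x) (g x)) y \<le> max (T f y) (T g y)"
proof -
  obtain h where h: "h \<in> C0_plus X" and Th: "T h = (\<lambda>y. max (T f y) (T g y))"
    using surjective[OF C0_plus_max[OF maps_into[OF f] maps_into[OF g]]] .
  have "f \<le> h" "g \<le> h"
    using le_iff[OF f h] le_iff[OF g h] by (auto simp: Th le_fun_def)
  then have "T (\<lambda>x. max (f x) (g x)) y \<le> T h y"
    by (intro mono C0_plus_max f g h) (simp add: le_fun_def)
  then show ?thesis
    by (simp add: Th)
qed

text \<open>Dually, the preimage of the pointwise minimum of \<open>T f\<close> and
  \<open>T g\<close> is a lower bound of \<open>f\<close> and \<open>g\<close>.\<close>

lemma min_ge:
  assumes f: "f \<in> C0_plus X" and g: "g \<in> C0_plus X"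
  shows "min (T f y) (T g y) \<le> T (\<lambda>x. min (f x) (g x)) y"
proof -
  obtain h where h: "h \<in> C0_plus X" and Th: "T h = (\<lambda>y. min (T f y) (T g y))"
    using surjective[OF C0_plus_min[OF maps_into[OF f] maps_into[OF g]]] .
  have "h \<le> f" "h \<le> g"
    using le_iff[OF h f] le_iff[OF h g] by (auto simp: Th le_fun_def)
  then have "T h y \<le> T (\<lambda>x. min (f x) (g x)) y"
    by (intro mono C0_plus_min f g h) (simp add: le_fun_def)
  then show ?thesis
    by (simp add: Th)
qed

lemma add_le:
  assumes f: "f \<in> C0_plus X" and g: "g \<in> C0_plus X"
  shows "T (\<lambda>x. f x + g x) y \<le> T f y + T g y"
proof (rule field_le_epsilon)
  fix e :: real
  assume e: "e > 0"
  \<comment> \<open>The slack \<open>e / 2\<close> makes both numbers positive even where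
    \<open>T f y\<close> or \<open>T g y\<close> is zero, so that division and positive homogeneity
    are available.\<close>
  define a b where "a = T f y + e / 2" and "b = T g y + e / 2"
  have ab: "a > 0" "b > 0" "T f y \<le> a" "T g y \<le> b"
    using e nonneg[OF f] nonneg[OF g] by (auto simp: a_def b_def add_nonneg_pos)
  \<comment> \<open>These are \<open>f/a\<close> and \<open>g/b\<close> rescaled by
    \<open>a + b\<close>: then \<open>f + g\<close> is the convex combination of \<open>p\<close>
    and \<open>q\<close> with weights \<open>a/(a + b)\<close> and \<open>b/(a + b)\<close>, while
    \<open>T p y\<close> and \<open>T q y\<close> are at most \<open>a + b\<close>.\<close>
  define p q where "p = (\<lambda>x. (a + b) / a * f x)" and "q = (\<lambda>x. (a + b) / b * g x)"
  have pq: "p \<in> C0_plus X" "q \<in> C0_plus X"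
    unfolding p_def q_def using ab by (intro C0_plus_scale f g; simp)+
  have "f x + g x \<le> max (p x) (q x)" for x
  proof -
    define m where "m = max (p x) (q x)"
    have "(a + b) * f x = a * p x" "(a + b) * g x = b * q x"
      using ab by (simp_all add: p_def q_def)
    moreover have "a * p x \<le> a * m" "b * q x \<le> b * m"
      using ab by (simp_all add: m_def)
    ultimately have "(a + b) * (f x + g x) \<le> (a + b) * m"
      by (simp add: algebra_simps)
    then show ?thesis
      using ab by (simp add: m_def)
  qed
  then have "T (\<lambda>x. f x + g x) y \<le> T (\<lambda>x. max (p x) (q x)) y"
    by (intro mono C0_plus_add C0_plus_max f g pq)
  also have "\<dots> \<le> max (T p y) (T q y)"
    by (rule max_le[OF pq])
  also have "\<dots> = max ((a + b) / a * T f y) ((a + b) / b * T g y)"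
    using ab scale[OF f, of "(a + b) / a"] scale[OF g, of "(a + b) / b"]
    unfolding p_def q_def by simp
  also have "\<dots> \<le> a + b"
    using ab mult_left_mono[of "T f y" a "a + b"] mult_left_mono[of "T g y" b "a + b"]
    by (simp add: field_simps)
  finally show "T (\<lambda>x. f x + g x) y \<le> T f y + T g y + e"
    by (simp add: a_def b_def)
qed

lemma add_ge:
  assumes f: "f \<in> C0_plus X" and g: "g \<in> C0_plus X"
  shows "T f y + T g y \<le> T (\<lambda>x. f x + g x) y"
proof (cases "T f y = 0 \<or> T g y = 0")
  case True
  have "T f y \<le> T (\<lambda>x. f x + g x) y" "T g y \<le> T (\<lambda>x. f x + g x) y"
    using f g by (auto intro!: mono C0_plus_add simp: C0_plus_iff C0_add)
  with True show ?thesis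
    by auto
next
  case False
  define a b where "a = T f y" and "b = T g y"
  have ab: "a > 0" "b > 0"
    using False nonneg[OF f, of y] nonneg[OF g, of y] by (auto simp: a_def b_def)
  define p q where "p = (\<lambda>x. (a + b) / a * f x)" and "q = (\<lambda>x. (a + b) / b * g x)"
  have pq: "p \<in> C0_plus X" "q \<in> C0_plus X"
    unfolding p_def q_def using ab by (intro C0_plus_scale f g; simp)+
  have "min (p x) (q x) \<le> f x + g x" for x
  proof -
    define m where "m = min (p x) (q x)"
    have "(a + b) * f x = a * p x" "(a + b) * g x = b * q x"
      using ab by (simp_all add: p_def q_def)
    moreover have "a * m \<le> a * p x" "b * m \<le> b * q x"
      using ab by (simp_all add: m_def)
    ultimately have "(a + b) * m \<le> (a + b) * (f x + g x)"
      by (simp add: algebra_simps)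
    then show ?thesis
      using ab by (simp add: m_def)
  qed
  then have "T (\<lambda>x. min (p x) (q x)) y \<le> T (\<lambda>x. f x + g x) y"
    by (intro mono C0_plus_add C0_plus_min f g pq)
  moreover have "min (T p y) (T q y) \<le> T (\<lambda>x. min (p x) (q x)) y"
    by (rule min_ge[OF pq])
  moreover have "T p y = a + b" "T q y = a + b"
    using ab scale[OF f, of "(a + b) / a"] scale[OF g, of "(a + b) / b"]
    unfolding p_def q_def by (simp_all flip: a_def b_def)
  ultimately show ?thesis
    by (simp add: a_def b_def)
qed

lemma additive:
  "f \<in> C0_plus X \<Longrightarrow> g \<in> C0_plus X \<Longrightarrow> T (\<lambda>x. f x + g x) = (\<lambda>y. T f y + T g y)"
  by (intro ext antisym add_le add_ge)

section \<open>The linear extension\<close>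

lemma zero: "T (\<lambda>x. 0) = (\<lambda>y. 0)"
  \<comment> \<open>Positive homogeneity speaks of \<open>r > 0\<close> only; the value at zero
    comes from \<open>0 + 0 = 0\<close>, which makes it equal to its own double.\<close>
  using additive[of "\<lambda>x. 0" "\<lambda>x. 0"] by (auto simp: C0_plus_iff C0_zero fun_eq_iff)

text \<open>\<open>restrict\<close> fixes the value outside \<open>C0 X\<close>, so that uniqueness
  can be an equality of total functions.\<close>

definition extension :: "('a \<Rightarrow> real) \<Rightarrow> ('b \<Rightarrow> real)" where
  "extension = restrict (\<lambda>f y. T (\<lambda>x. max (f x) 0) y - T (\<lambda>x. max (- f x) 0) y) (C0 X)"

text \<open>Independence of the decomposition: \<open>f\<^sup>+ + q = p + f\<^sup>-\<close> is an
  identity inside the cone, to which additivity applies. Later proofs can thus choose whichever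
  decomposition is convenient.\<close>

lemma extension_eq_diff:
  assumes p: "p \<in> C0_plus X" and q: "q \<in> C0_plus X" and f: "\<And>x. f x = p x - q x"
  shows "extension f = (\<lambda>y. T p y - T q y)"
proof -
  have "f = (\<lambda>x. p x - q x)"
    by (rule ext) (rule f)
  then have fC: "f \<in> C0 X"
    using p q by (simp add: C0_plus_iff C0_diff)
  have "(\<lambda>x. max (f x) 0 + q x) = (\<lambda>x. p x + max (- f x) 0)"
    by (auto simp: f)
  then have "T (\<lambda>x. max (f x) 0 + q x) = T (\<lambda>x. p x + max (- f x) 0)"
    by simp
  then have "T (\<lambda>x. max (f x) 0) y + T q y = T p y + T (\<lambda>x. max (- f x) 0) y" for y
    using additive[OF C0_pos_part[OF fC] q] additive[OF p C0_neg_part[OF fC]]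
    by (simp add: fun_eq_iff)
  then show ?thesis
    using fC by (auto simp: extension_def fun_eq_iff algebra_simps)
qed

text \<open>The space \<open>Z\<close> is arbitrary because surjectivity of the extension needs the
  decomposition over \<open>Y\<close>.\<close>

lemma C0_decompose:
  assumes "f \<in> C0 Z"
  obtains p q where "p \<in> C0_plus Z" "q \<in> C0_plus Z" "f = (\<lambda>x. p x - q x)"
proof
  show "f = (\<lambda>x. max (f x) 0 - max (- f x) 0)"
    by (rule ext) simp
qed (use assms in \<open>auto intro: C0_pos_part C0_neg_part\<close>)

lemma extension_extends: "f \<in> C0_plus X \<Longrightarrow> extension f = T f"
  using extension_eq_diff[of f "\<lambda>x. 0" f] by (simp add: C0_plus_iff C0_zero zero)

section \<open>Linearity, order and bijectivity of the extension\<close>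

lemma extension_linear: "linear_map_on (C0 X) extension"
  unfolding linear_map_on_def
proof (intro conjI ballI allI)
  fix f g
  assume "f \<in> C0 X" "g \<in> C0 X"
  obtain p q where pq: "p \<in> C0_plus X" "q \<in> C0_plus X" "f = (\<lambda>x. p x - q x)"
    using C0_decompose[OF \<open>f \<in> C0 X\<close>] .
  obtain p' q' where pq': "p' \<in> C0_plus X" "q' \<in> C0_plus X" "g = (\<lambda>x. p' x - q' x)"
    using C0_decompose[OF \<open>g \<in> C0 X\<close>] .
  have "extension (\<lambda>x. f x + g x) =
      (\<lambda>y. T (\<lambda>x. p x + p' x) y - T (\<lambda>x. q x + q' x) y)"
    using pq pq' by (intro extension_eq_diff C0_plus_add) auto
  then show "extension (\<lambda>x. f x + g x) = (\<lambda>y. extension f y + extension g y)"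
    using pq pq' by (simp add: additive extension_eq_diff[of p q] extension_eq_diff[of p' q']
        algebra_simps)
next
  fix r :: real and f
  assume "f \<in> C0 X"
  then obtain p q where pq: "p \<in> C0_plus X" "q \<in> C0_plus X" "f = (\<lambda>x. p x - q x)"
    by (rule C0_decompose)
  have f: "extension f = (\<lambda>y. T p y - T q y)"
    using pq by (intro extension_eq_diff) auto
  consider "r > 0" | "r = 0" | "r < 0"
    by linarith
  then show "extension (\<lambda>x. r * f x) = (\<lambda>y. r * extension f y)"
  proof cases
    case 1
    then have "extension (\<lambda>x. r * f x) = (\<lambda>y. T (\<lambda>x. r * p x) y - T (\<lambda>x. r * q x) y)"
      using pq by (intro extension_eq_diff C0_plus_scale) (auto simp: algebra_simps)
    then show ?thesis
      using 1 pq f by (simp add: scale algebra_simps)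
  next
    case 2
    then show ?thesis
      using extension_extends[of "\<lambda>x. 0"] by (simp add: C0_plus_iff C0_zero zero)
  next
    case 3
    \<comment> \<open>For negative \<open>r\<close> the two parts change roles, so that the
      coefficient \<open>- r\<close> is positive and both products stay in the cone.\<close>
    then have "extension (\<lambda>x. r * f x) = (\<lambda>y. T (\<lambda>x. (- r) * q x) y - T (\<lambda>x. (- r) * p x) y)"
      using pq by (intro extension_eq_diff C0_plus_scale) (auto simp: algebra_simps)
    then show ?thesis
      using 3 pq f scale[of p "- r"] scale[of q "- r"] by (simp add: algebra_simps)
  qed
qed

text \<open>Moving the subtracted parts to the other side turns both inequalities into comparisons
  within the cones, where \<open>T\<close> preserves and reflects the order.\<close>

lemma extension_le_iff:
  assumes "f \<in> C0 X" "g \<in> C0 X"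
  shows "extension f \<le> extension g \<longleftrightarrow> f \<le> g"
proof -
  obtain p q where pq: "p \<in> C0_plus X" "q \<in> C0_plus X" "f = (\<lambda>x. p x - q x)"
    using C0_decompose[OF assms(1)] .
  obtain p' q' where pq': "p' \<in> C0_plus X" "q' \<in> C0_plus X" "g = (\<lambda>x. p' x - q' x)"
    using C0_decompose[OF assms(2)] .
  have "extension f \<le> extension g \<longleftrightarrow> (\<forall>y. T p y + T q' y \<le> T p' y + T q y)"
    using pq pq' by (simp add: extension_eq_diff[of p q] extension_eq_diff[of p' q'] le_fun_def
        algebra_simps)
  also have "\<dots> \<longleftrightarrow> T (\<lambda>x. p x + q' x) \<le> T (\<lambda>x. p' x + q x)"
    using pq pq' by (simp add: additive le_fun_def)
  also have "\<dots> \<longleftrightarrow> (\<lambda>x. p x + q' x) \<le> (\<lambda>x. p' x + q x)"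
    using pq pq' by (intro le_iff C0_plus_add)
  also have "\<dots> \<longleftrightarrow> f \<le> g"
    by (simp add: pq pq' le_fun_def algebra_simps)
  finally show ?thesis .
qed

lemma extension_image: "extension ` C0 X = C0 Y"
proof (intro equalityI subsetI)
  fix g
  assume "g \<in> extension ` C0 X"
  then obtain f where f: "f \<in> C0 X" and g: "g = extension f"
    by blast
  obtain p q where pq: "p \<in> C0_plus X" "q \<in> C0_plus X" "f = (\<lambda>x. p x - q x)"
    using C0_decompose[OF f] .
  then have "g = (\<lambda>y. T p y - T q y)"
    unfolding g by (intro extension_eq_diff) auto
  then show "g \<in> C0 Y"
    using maps_into[OF pq(1)] maps_into[OF pq(2)] by (auto simp: C0_plus_iff intro: C0_diff)
next
  fix g
  assume "g \<in> C0 Y"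
  then obtain p q where pq: "p \<in> C0_plus Y" "q \<in> C0_plus Y" "g = (\<lambda>x. p x - q x)"
    by (rule C0_decompose)
  obtain p' where p': "p' \<in> C0_plus X" "T p' = p"
    using surjective[OF pq(1)] .
  obtain q' where q': "q' \<in> C0_plus X" "T q' = q"
    using surjective[OF pq(2)] .
  have "extension (\<lambda>x. p' x - q' x) = g"
    using p' q' pq by (simp add: extension_eq_diff[of p' q'])
  moreover have "(\<lambda>x. p' x - q' x) \<in> C0 X"
    using p' q' by (auto simp: C0_plus_iff intro: C0_diff)
  ultimately show "g \<in> extension ` C0 X"
    by blast
qed

lemma extension_linear_order_isomorphism: "linear_order_isomorphism X Y extension"
proof -
  have "inj_on extension (C0 X)"
    \<comment> \<open>Injectivity is order reflection applied in both directions, followed by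
      antisymmetry.\<close>
    by (rule inj_onI, rule antisym) (simp_all flip: extension_le_iff)
  then show ?thesis
    using extension_linear extension_image extension_le_iff
    by (simp add: linear_order_isomorphism_def order_isomorphism_on_def bij_betw_def)
qed

section \<open>Uniqueness of the extension\<close>

lemma linear_extension_unique:
  assumes S: "linear_map_on (C0 X) S" and ext: "\<And>f. f \<in> C0_plus X \<Longrightarrow> S f = T f"
    and f: "f \<in> C0 X"
  shows "S f = extension f"
proof -
  obtain p q where pq: "p \<in> C0_plus X" "q \<in> C0_plus X" "f = (\<lambda>x. p x - q x)"
    using C0_decompose[OF f] .
  have "q \<in> C0 X"
    using pq by (simp add: C0_plus_iff)
  \<comment> \<open>Since \<open>f + q = p\<close> with \<open>p\<close> and \<open>q\<close> in the
    cone, additivity of \<open>S\<close> forces \<open>S f = T p - T q\<close>.\<close>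
  then have "S (\<lambda>x. f x + q x) = (\<lambda>y. S f y + S q y)"
    using S f by (simp add: linear_map_on_def)
  moreover have "(\<lambda>x. f x + q x) = p"
    by (simp add: pq)
  ultimately have "T p = (\<lambda>y. S f y + T q y)"
    using pq ext by simp
  then show ?thesis
    using pq by (simp add: extension_eq_diff[of p q])
qed

end

theorem corollary1p2:
  fixes X :: "'a topology" and Y :: "'b topology"
    and T :: "('a \<Rightarrow> real) \<Rightarrow> ('b \<Rightarrow> real)"
  assumes "locally_compact_space X" and "Hausdorff_space X"
    and "locally_compact_space Y" and "Hausdorff_space Y"
    and "order_isomorphism_on (C0_plus X) (C0_plus Y) T"
    and "positive_homogeneous_on (C0_plus X) T"
  shows "\<exists>!T'. T' \<in> extensional (C0 X) \<and> linear_order_isomorphism X Y T' \<and>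
               (\<forall>f \<in> C0_plus X. T' f = T f)"
proof -
  interpret homogeneous_order_isomorphism X Y T
    using assms by unfold_locales
  show ?thesis
  proof (rule ex1I[of _ extension], intro conjI ballI)
    show "extension \<in> extensional (C0 X)"
      by (simp add: extension_def)
  next
    fix S
    assume "S \<in> extensional (C0 X) \<and> linear_order_isomorphism X Y S \<and>
      (\<forall>f \<in> C0_plus X. S f = T f)"
    then show "S = extension"
      \<comment> \<open>Both maps are extensional on \<open>C0 X\<close>, so agreement there is
        equality everywhere.\<close>
      by (intro extensionalityI[where A = "C0 X"] linear_extension_unique)
        (auto simp: linear_order_isomorphism_def extension_def)
  qed (fact extension_linear_order_isomorphism, fact extension_extends)
qed

end
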